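(* Let $\mathcal{Q}=(Q,\preceq,I,\circ)$ be a quantale. For any $\mathcal{Q}$-category $\mathcal{C}$, its MacNeille completion $\mathcal{M}\mathcal{C}$, together with the canonical embedding $i_{\mathcal{C}}\colon \mathcal{C}\to\mathcal{M}\mathcal{C}$, $i_{\mathcal{C}}(c)=(\mathcal{C}(-,c),\mathcal{C}(c,-))$, is an injective envelope of $\mathcal{C}$ (in the category of $\mathcal{Q}$-categories and $\mathcal{Q}$-functors, with respect to the class of fully faithful $\mathcal{Q}$-functors).
   Context: A (unital, not necessarily commutative) quantale $\mathcal{Q}=(Q,\preceq,I,\circ)$ is a complete lattice $(Q,\preceq)$ with a monoid structure $(Q,I,\circ)$ such that $\circ$ preserves arbitrary suprema in each variable. The residuations $\swarrow$ and $\searrow$ are defined by $y\preceq z\swarrow x \iff y\circ x\preceq z \iff x\preceq y\searrow z$. A $\mathcal{Q}$-category $\mathcal{C}$ consists of a set $\mathrm{ob}(\mathcal{C})$ (one writes $c\in\mathcal{C}$ for $c\in\mathrm{ob}(\mathcal{C})$) and elements $\mathcal{C}(c,c')\in Q$ for $c,c'\in\mathcal{C}$ such that $I\preceq\mathcal{C}(c,c)$ and $\mathcal{C}(c',c'')\circ\mathcal{C}(c,c')\preceq\mathcal{C}(c,c'')$ for all $c,c',c''$. A $\mathcal{Q}$-functor $f\colon\mathcal{C}\to\mathcal{D}$ is a function $\mathrm{ob}(\mathcal{C})\to\mathrm{ob}(\mathcal{D})$ with $\mathcal{C}(c,c')\preceq\mathcal{D}(f(c),f(c'))$ for all $c,c'$;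 it is fully faithful (an embedding) if equality always holds. A presheaf over $\mathcal{C}$ is a family $P=(Pc)_{c\in\mathcal{C}}$ in $Q$ with $Pc'\circ\mathcal{C}(c,c')\preceq Pc$ for all $c,c'$; presheaves form a $\mathcal{Q}$-category $\mathcal{P}\mathcal{C}$ with $\mathcal{P}\mathcal{C}(P,P')=\bigwedge_{c}P'c\swarrow Pc$. A copresheaf over $\mathcal{C}$ is a family $R=(Rc)_{c\in\mathcal{C}}$ in $Q$ with $\mathcal{C}(c,c')\circ Rc\preceq Rc'$ for all $c,c'$; copresheaves form a $\mathcal{Q}$-category $\mathcal{P}^\dagger\mathcal{C}$ with $\mathcal{P}^\dagger\mathcal{C}(R,R')=\bigwedge_{c}R'c\searrow Rc$. For a presheaf $P$, the copresheaf $\mathcal{C}\swarrow P$ is $(\mathcal{C}\swarrow P)c=\bigwedge_{c'\in\mathcal{C}}\mathcal{C}(c',c)\swarrow Pc'$; for a copresheaf $R$, the presheaf $R\searrow\mathcal{C}$ is $(R\searrow\mathcal{C})c=\bigwedge_{c'\in\mathcal{C}}Rc'\searrow\mathcal{C}(c,c')$. The MacNeille completion $\mathcal{M}\mathcal{C}$ is the $\mathcal{Q}$-category whose objects are pairs $(P,R)$ of a presheaf $P$ and a copresheaf $R$ over $\mathcal{C}$ with $P=R\searrow\mathcal{C}$ and $R=\mathcal{C}\swarrow P$, and with $\mathcal{M}\mathcal{C}((P,R),(P',R'))=\mathcal{P}\mathcal{C}(P,P')$ (which equals $\mathcal{P}^\dagger\mathcal{C}(R,R')$). Here $\mathcal{C}(-,c)=(\mathcal{C}(c',c))_{c'\in\mathcal{C}}$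 and $\mathcal{C}(c,-)=(\mathcal{C}(c,c'))_{c'\in\mathcal{C}}$. A $\mathcal{Q}$-category $\mathcal{E}$ is injective if for every $\mathcal{Q}$-functor $f\colon\mathcal{C}\to\mathcal{E}$ and every embedding $i\colon\mathcal{C}\to\mathcal{D}$ there is a (not necessarily unique) $\mathcal{Q}$-functor $g\colon\mathcal{D}\to\mathcal{E}$ with $f=g\circ i$. A $\mathcal{Q}$-functor $f\colon\mathcal{C}\to\mathcal{D}$ is an essential embedding if it is an embedding and, for any $\mathcal{Q}$-functor $g\colon\mathcal{D}\to\mathcal{E}$, if $g\circ f$ is an embedding then so is $g$. An injective envelope of $\mathcal{C}$ is a pair $(\mathcal{D},f)$ of an injective $\mathcal{Q}$-category $\mathcal{D}$ and an essential embedding $f\colon\mathcal{C}\to\mathcal{D}$. *)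

theory Defs
  imports "HOL-Library.FuncSet"
begin

text \<open>
  The order of the quantale is \<open>\<le>\<close>, its unit \<open>I\<close> is \<open>1\<close>, and its multiplication
  \<open>\<circ>\<close> is \<open>*\<close>.
\<close>

class quantale = complete_lattice + monoid_mult +
  assumes Sup_mult_distrib: "Sup A * y = Sup ((\<lambda>x. x * y) ` A)"
    and mult_Sup_distrib: "x * Sup B = Sup ((\<lambda>y. x * y) ` B)"

definition lres :: "'q::quantale \<Rightarrow> 'q \<Rightarrow> 'q"  (infix "\<swarrow>" 65)
  where "z \<swarrow> x = Sup {y. y * x \<le> z}"

definition rres :: "'q::quantale \<Rightarrow> 'q \<Rightarrow> 'q"  (infix "\<searrow>" 65)
  where "y \<searrow> z = Sup {x. y * x \<le> z}"

text \<open>The two lemmas below are the defining adjunctions of the residuations.\<close>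

lemma le_lres_iff: "y \<le> z \<swarrow> x \<longleftrightarrow> y * x \<le> z"
  for x y z :: "'q::quantale"
proof
  assume "y \<le> z \<swarrow> x"
  then have "sup y (z \<swarrow> x) = z \<swarrow> x"
    by (rule sup_absorb2)
  moreover have "sup y (z \<swarrow> x) * x = sup (y * x) ((z \<swarrow> x) * x)"
    using Sup_mult_distrib[of "{y, z \<swarrow> x}" x] by simp
  ultimately have "y * x \<le> (z \<swarrow> x) * x"
    by (metis sup_ge1)
  also have "\<dots> \<le> z"
    unfolding lres_def Sup_mult_distrib by (auto intro: Sup_least)
  finally show "y * x \<le> z" .
qed (auto simp: lres_def intro: Sup_upper)

lemma le_rres_iff: "x \<le> y \<searrow> z \<longleftrightarrow> y * x \<le> z"
  for x y z :: "'q::quantale"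
proof
  assume "x \<le> y \<searrow> z"
  then have "sup x (y \<searrow> z) = y \<searrow> z"
    by (rule sup_absorb2)
  moreover have "y * sup x (y \<searrow> z) = sup (y * x) (y * (y \<searrow> z))"
    using mult_Sup_distrib[of y "{x, y \<searrow> z}"] by simp
  ultimately have "y * x \<le> y * (y \<searrow> z)"
    by (metis sup_ge1)
  also have "\<dots> \<le> z"
    unfolding rres_def mult_Sup_distrib by (auto intro: Sup_least)
  finally show "y * x \<le> z" .
qed (auto simp: rres_def intro: Sup_upper)

text \<open>
  The objects of a category form an arbitrary, possibly empty, set. Values of \<open>hom\<close>, and of
  functors, outside the object sets are irrelevant.
\<close>

record ('a, 'q) qcat =
  ob :: "'a set"
  hom :: "'a \<Rightarrow> 'a \<Rightarrow> 'q"

definition qcategory :: "('a, 'q::quantale) qcat \<Rightarrow> bool"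
  where "qcategory C \<longleftrightarrow>
    (\<forall>c\<in>ob C. 1 \<le> hom C c c) \<and>
    (\<forall>c\<in>ob C. \<forall>c'\<in>ob C. \<forall>c''\<in>ob C. hom C c' c'' * hom C c c' \<le> hom C c c'')"

definition qfunctor :: "('a, 'q::quantale) qcat \<Rightarrow> ('b, 'q) qcat \<Rightarrow> ('a \<Rightarrow> 'b) \<Rightarrow> bool"
  where "qfunctor C D f \<longleftrightarrow>
    qcategory C \<and> qcategory D \<and> f \<in> ob C \<rightarrow> ob D \<and>
    (\<forall>c\<in>ob C. \<forall>c'\<in>ob C. hom C c c' \<le> hom D (f c) (f c'))"

definition embedding :: "('a, 'q::quantale) qcat \<Rightarrow> ('b, 'q) qcat \<Rightarrow> ('a \<Rightarrow> 'b) \<Rightarrow> bool"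
  where "embedding C D f \<longleftrightarrow>
    qfunctor C D f \<and> (\<forall>c\<in>ob C. \<forall>c'\<in>ob C. hom C c c' = hom D (f c) (f c'))"

text \<open>
  Families indexed by \<open>ob C\<close> are functions that are \<^const>\<open>undefined\<close> outside \<open>ob C\<close>, so that
  equality of functions is equality of families.
\<close>

definition presheaf :: "('a, 'q::quantale) qcat \<Rightarrow> ('a \<Rightarrow> 'q) \<Rightarrow> bool"
  where "presheaf C P \<longleftrightarrow>
    P \<in> extensional (ob C) \<and> (\<forall>c\<in>ob C. \<forall>c'\<in>ob C. P c' * hom C c c' \<le> P c)"

definition copresheaf :: "('a, 'q::quantale) qcat \<Rightarrow> ('a \<Rightarrow> 'q) \<Rightarrow> bool"
  where "copresheaf C R \<longleftrightarrow>
    R \<in> extensional (ob C) \<and> (\<forall>c\<in>ob C. \<forall>c'\<in>ob C. hom C c c' * R c \<le> R c')"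

definition presheaf_cat :: "('a, 'q::quantale) qcat \<Rightarrow> ('a \<Rightarrow> 'q, 'q) qcat"
  where "presheaf_cat C =
    \<lparr>ob = {P. presheaf C P}, hom = (\<lambda>P P'. INF c\<in>ob C. P' c \<swarrow> P c)\<rparr>"

text \<open>The copresheaf \<open>C \<swarrow> P\<close> and the presheaf \<open>R \<searrow> C\<close>.\<close>

definition upper :: "('a, 'q::quantale) qcat \<Rightarrow> ('a \<Rightarrow> 'q) \<Rightarrow> ('a \<Rightarrow> 'q)"
  where "upper C P = (\<lambda>c\<in>ob C. INF c'\<in>ob C. hom C c' c \<swarrow> P c')"

definition lower :: "('a, 'q::quantale) qcat \<Rightarrow> ('a \<Rightarrow> 'q) \<Rightarrow> ('a \<Rightarrow> 'q)"
  where "lower C R = (\<lambda>c\<in>ob C. INF c'\<in>ob C. R c' \<searrow> hom C c c')"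

definition macneille :: "('a, 'q::quantale) qcat \<Rightarrow> (('a \<Rightarrow> 'q) \<times> ('a \<Rightarrow> 'q), 'q) qcat"
  where "macneille C =
    \<lparr>ob = {(P, R). presheaf C P \<and> copresheaf C R \<and> P = lower C R \<and> R = upper C P},
     hom = (\<lambda>(P, R) (P', R'). hom (presheaf_cat C) P P')\<rparr>"

definition macneille_embedding ::
    "('a, 'q::quantale) qcat \<Rightarrow> 'a \<Rightarrow> ('a \<Rightarrow> 'q) \<times> ('a \<Rightarrow> 'q)"
  where "macneille_embedding C c = (\<lambda>c'\<in>ob C. hom C c' c, \<lambda>c'\<in>ob C. hom C c c')"

text \<open>
  Injectivity and essentiality quantify over all categories. HOL cannot quantify over types inside
  a formula, so the types of objects of the quantified categories are parameters; a statement
  in which these parameters are type variables is about all categories. Equations between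
  functors are equations on the objects of their common domain.
\<close>

definition injective ::
    "'x itself \<Rightarrow> 'y itself \<Rightarrow> ('e, 'q::quantale) qcat \<Rightarrow> bool"
  where "injective TYPE('x) TYPE('y) E \<longleftrightarrow>
    qcategory E \<and>
    (\<forall>(C :: ('x, 'q) qcat) (D :: ('y, 'q) qcat) f i.
      qfunctor C E f \<longrightarrow> embedding C D i \<longrightarrow>
      (\<exists>g. qfunctor D E g \<and> (\<forall>c\<in>ob C. f c = (g \<circ> i) c)))"

definition essential_embedding ::
    "'z itself \<Rightarrow> ('a, 'q::quantale) qcat \<Rightarrow> ('b, 'q) qcat \<Rightarrow> ('a \<Rightarrow> 'b) \<Rightarrow> bool"
  where "essential_embedding TYPE('z) C D f \<longleftrightarrow>
    embedding C D f \<and>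
    (\<forall>(E :: ('z, 'q) qcat) g.
      qfunctor D E g \<longrightarrow> embedding C E (g \<circ> f) \<longrightarrow> embedding D E g)"

definition injective_envelope ::
    "'x itself \<Rightarrow> 'y itself \<Rightarrow> 'z itself \<Rightarrow>
     ('a, 'q::quantale) qcat \<Rightarrow> ('b, 'q) qcat \<Rightarrow> ('a \<Rightarrow> 'b) \<Rightarrow> bool"
  where "injective_envelope TYPE('x) TYPE('y) TYPE('z) C D f \<longleftrightarrow>
    injective TYPE('x) TYPE('y) D \<and> essential_embedding TYPE('z) C D f"

end

theory Submission
  imports Defs
begin

text \<open>
  Injectivity: a functor \<open>f\<close> into the completion is extended along an embedding \<open>i\<close> by sending
  \<open>y\<close> to the colimit of \<open>f\<close> weighted by \<open>D(i -, y)\<close>, that is, to the closure under the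
  \<open>upper\<close>/\<open>lower\<close> Galois connection of the presheaf \<open>c \<mapsto> \<Squnion>x. D(i x, y) \<circ> (f x) c\<close>. The
  extension is strict because objects of the completion with the same presheaf are equal.

  Essentiality: write \<open>M = (P, R)\<close> and \<open>M' = (P', R')\<close>. By the Yoneda lemma \<open>P c\<close> and \<open>R' c'\<close>
  are homs from \<open>i c\<close> to \<open>M\<close> and from \<open>M'\<close> to \<open>i c'\<close>, so a functor \<open>g\<close> satisfies
  \<open>R' c' \<circ> E(g M, g M') \<circ> P c \<le> E(g (i c), g (i c'))\<close>. If \<open>g\<close> is an embedding on the image of
  \<open>i\<close>, the right-hand side is \<open>C(c, c')\<close>, and residuation gives \<open>E(g M, g M') \<circ> P c \<le> P' c\<close>.
\<close>

section \<open>Monotonicity of multiplication and composition of bounds on homs\<close>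

lemma quantale_mult_right_mono:
  fixes x y z :: "'q::quantale"
  assumes "x \<le> y" shows "x * z \<le> y * z"
  using assms le_lres_iff[of x "y * z" z] le_lres_iff[of y "y * z" z] by (auto intro: order_trans)

lemma quantale_mult_left_mono:
  fixes x y z :: "'q::quantale"
  assumes "x \<le> y" shows "z * x \<le> z * y"
  using assms le_rres_iff[of x z "z * y"] le_rres_iff[of y z "z * y"] by (auto intro: order_trans)

lemma quantale_mult_mono:
  fixes x y z w :: "'q::quantale"
  assumes "x \<le> y" "z \<le> w" shows "x * z \<le> y * w"
  using assms quantale_mult_left_mono quantale_mult_right_mono order_trans by metis

lemma qcategory_id: "qcategory C \<Longrightarrow> c \<in> ob C \<Longrightarrow> 1 \<le> hom C c c"
  by (simp add: qcategory_def)

lemma qcategory_comp: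
  "qcategory C \<Longrightarrow> c \<in> ob C \<Longrightarrow> c' \<in> ob C \<Longrightarrow> c'' \<in> ob C \<Longrightarrow>
    hom C c' c'' * hom C c c' \<le> hom C c c''"
  by (simp add: qcategory_def)

lemma qcategory_comp_le:
  assumes "qcategory C" "c \<in> ob C" "c' \<in> ob C" "c'' \<in> ob C" "x \<le> hom C c' c''" "y \<le> hom C c c'"
  shows "x * y \<le> hom C c c''"
  using qcategory_comp[OF assms(1-4)] quantale_mult_mono[OF assms(5,6)] by (rule order_trans[rotated])

section \<open>The Galois connection between \<open>upper\<close> and \<open>lower\<close>\<close>

lemma le_upper_iff:
  "c \<in> ob C \<Longrightarrow> x \<le> upper C P c \<longleftrightarrow> (\<forall>c'\<in>ob C. x * P c' \<le> hom C c' c)"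
  by (simp add: upper_def le_INF_iff le_lres_iff)

lemma le_lower_iff:
  "c \<in> ob C \<Longrightarrow> x \<le> lower C R c \<longleftrightarrow> (\<forall>c'\<in>ob C. R c' * x \<le> hom C c c')"
  by (simp add: lower_def le_INF_iff le_rres_iff)

lemma upper_mult_le: "c \<in> ob C \<Longrightarrow> c' \<in> ob C \<Longrightarrow> upper C P c * P c' \<le> hom C c' c"
  using le_upper_iff[of c C "upper C P c" P] by simp

lemma mult_lower_le: "c \<in> ob C \<Longrightarrow> c' \<in> ob C \<Longrightarrow> R c' * lower C R c \<le> hom C c c'"
  using le_lower_iff[of c C "lower C R c" R] by simp

lemma copresheaf_upper:
  assumes "qcategory C" shows "copresheaf C (upper C P)"
  unfolding copresheaf_def
proof (intro conjI ballI)
  fix c c' assume c: "c \<in> ob C" "c' \<in> ob C"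
  have "hom C c c' * upper C P c * P d \<le> hom C d c'" if "d \<in> ob C" for d
    unfolding mult.assoc
    by (rule qcategory_comp_le[OF assms that c order_refl upper_mult_le[OF c(1) that]])
  then show "hom C c c' * upper C P c \<le> upper C P c'"
    using c by (simp add: le_upper_iff)
qed (simp add: upper_def)

lemma presheaf_lower:
  assumes "qcategory C" shows "presheaf C (lower C R)"
  unfolding presheaf_def
proof (intro conjI ballI)
  fix c c' assume c: "c \<in> ob C" "c' \<in> ob C"
  have "R d * (lower C R c' * hom C c c') \<le> hom C c d" if "d \<in> ob C" for d
    unfolding mult.assoc[symmetric]
    by (rule qcategory_comp_le[OF assms c that mult_lower_le[OF c(2) that] order_refl])
  then show "lower C R c' * hom C c c' \<le> lower C R c"
    using c by (simp add: le_lower_iff)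
qed (simp add: lower_def)

text \<open>Enriched antitonicity: multiplying \<open>q * P c' \<le> P' c'\<close> on the left by
  \<open>upper C P' c\<close> gives a product below \<open>hom C c' c\<close>, and residuation
  concludes. The scalar \<open>q\<close> makes \<open>upper\<close> a contravariant functor;
  \<open>q = 1\<close> is ordinary antitonicity.\<close>

lemma mult_upper_le:
  assumes "\<And>c. c \<in> ob C \<Longrightarrow> q * P c \<le> P' c" "c \<in> ob C"
  shows "upper C P' c * q \<le> upper C P c"
proof -
  have "upper C P' c * (q * P c') \<le> hom C c' c" if "c' \<in> ob C" for c'
    by (rule order_trans[OF quantale_mult_left_mono upper_mult_le]) (use assms that in auto)
  then show ?thesis
    using assms(2) by (simp add: le_upper_iff mult.assoc)
qed

lemma lower_mult_le:
  assumes "\<And>c. c \<in> ob C \<Longrightarrow> R' c * q \<le> R c" "c \<in> ob C"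
  shows "q * lower C R c \<le> lower C R' c"
proof -
  have "R' c' * q * lower C R c \<le> hom C c c'" if "c' \<in> ob C" for c'
    by (rule order_trans[OF quantale_mult_right_mono mult_lower_le]) (use assms that in auto)
  then show ?thesis
    using assms(2) by (simp add: le_lower_iff mult.assoc)
qed

lemma le_lower_upper: "c \<in> ob C \<Longrightarrow> P c \<le> lower C (upper C P) c"
  by (simp add: le_lower_iff upper_mult_le)

lemma le_upper_lower: "c \<in> ob C \<Longrightarrow> R c \<le> upper C (lower C R) c"
  by (simp add: le_upper_iff mult_lower_le)

text \<open>The triangle identity of the Galois connection: the units at \<open>P\<close> and at
  \<open>upper C P\<close>, the former reversed by \<open>upper\<close>, give the two
  inequalities.\<close>

lemma upper_lower_upper: "upper C (lower C (upper C P)) = upper C P"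
proof (rule extensionalityI[of _ "ob C"])
  fix c assume c: "c \<in> ob C"
  have "upper C (lower C (upper C P)) c * 1 \<le> upper C P c"
    by (rule mult_upper_le) (simp_all add: c le_lower_upper)
  then show "upper C (lower C (upper C P)) c = upper C P c"
    using le_upper_lower[OF c, of "upper C P"] by (simp add: antisym)
qed (simp_all add: upper_def)

section \<open>Objects and homs of the completion\<close>

lemma macneille_obI:
  assumes "qcategory C" "P = lower C R" "R = upper C P"
  shows "(P, R) \<in> ob (macneille C)"
proof -
  \<comment> \<open>Any value of \<open>lower\<close> is a presheaf and any value of
    \<open>upper\<close> a copresheaf, so the two fixed-point equations suffice.\<close>
  have "presheaf C P"
    unfolding assms(2) by (rule presheaf_lower[OF assms(1)])
  moreover have "copresheaf C R"
    unfolding assms(3) by (rule copresheaf_upper[OF assms(1)])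
  ultimately show ?thesis
    unfolding macneille_def qcat.select_convs mem_Collect_eq case_prod_conv
    by (intro conjI assms(2,3))
qed

lemma macneille_ob:
  assumes "M \<in> ob (macneille C)"
  shows "presheaf C (fst M)" "lower C (snd M) = fst M" "upper C (fst M) = snd M"
proof -
  have "presheaf C (fst M) \<and> copresheaf C (snd M) \<and>
      fst M = lower C (snd M) \<and> snd M = upper C (fst M)"
    using assms unfolding macneille_def qcat.select_convs mem_Collect_eq case_prod_beta .
  then show "presheaf C (fst M)" "lower C (snd M) = fst M" "upper C (fst M) = snd M"
    by (blast intro: sym)+
qed

text \<open>A hom here is a meet of residuals, so it is determined by the elements below it; later
  proofs handle it in this form.\<close>

lemma le_macneille_hom_iff:
  "x \<le> hom (macneille C) M M' \<longleftrightarrow> (\<forall>c\<in>ob C. x * fst M c \<le> fst M' c)"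
  by (simp add: macneille_def presheaf_cat_def case_prod_beta le_INF_iff le_lres_iff)

lemma macneille_hom_mult_le:
  "c \<in> ob C \<Longrightarrow> hom (macneille C) M M' * fst M c \<le> fst M' c"
  using le_macneille_hom_iff[of "hom (macneille C) M M'" C M M'] by simp

lemma qcategory_macneille: "qcategory (macneille C)"
  unfolding qcategory_def
proof (intro conjI ballI)
  fix M M' M'' :: "('a \<Rightarrow> 'b) \<times> ('a \<Rightarrow> 'b)"
  show "1 \<le> hom (macneille C) M M"
    by (simp add: le_macneille_hom_iff)
  show "hom (macneille C) M' M'' * hom (macneille C) M M' \<le> hom (macneille C) M M''"
    unfolding le_macneille_hom_iff mult.assoc
    by (rule ballI, rule order_trans[OF quantale_mult_left_mono])
      (rule macneille_hom_mult_le, assumption)+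
qed

section \<open>Representables and the Yoneda lemma\<close>

lemma upper_representable:
  assumes "qcategory C" "c \<in> ob C"
  shows "upper C (\<lambda>c'\<in>ob C. hom C c' c) = (\<lambda>c'\<in>ob C. hom C c c')"
proof (rule extensionalityI[of _ "ob C"])
  fix d assume d: "d \<in> ob C"
  \<comment> \<open>The bound defining \<open>upper\<close> is tested at \<open>c\<close> itself,
    where \<open>1 \<le> hom C c c\<close> removes the extra factor.\<close>
  have "upper C (\<lambda>c'\<in>ob C. hom C c' c) d * 1 \<le> upper C (\<lambda>c'\<in>ob C. hom C c' c) d * hom C c c"
    by (intro quantale_mult_left_mono qcategory_id assms)
  also have "\<dots> \<le> hom C c d"
    using upper_mult_le[OF d assms(2), of "\<lambda>c'\<in>ob C. hom C c' c"] assms(2) by simp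
  finally have "upper C (\<lambda>c'\<in>ob C. hom C c' c) d \<le> hom C c d"
    by simp
  moreover have "hom C c d \<le> upper C (\<lambda>c'\<in>ob C. hom C c' c) d"
    using assms d by (simp add: le_upper_iff qcategory_comp)
  ultimately show "upper C (\<lambda>c'\<in>ob C. hom C c' c) d = (\<lambda>c'\<in>ob C. hom C c c') d"
    using d by simp
qed (simp_all add: upper_def)

lemma lower_representable:
  assumes "qcategory C" "c \<in> ob C"
  shows "lower C (\<lambda>c'\<in>ob C. hom C c c') = (\<lambda>c'\<in>ob C. hom C c' c)"
proof (rule extensionalityI[of _ "ob C"])
  fix d assume d: "d \<in> ob C"
  have "1 * lower C (\<lambda>c'\<in>ob C. hom C c c') d \<le> hom C c c * lower C (\<lambda>c'\<in>ob C. hom C c c') d"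
    by (intro quantale_mult_right_mono qcategory_id assms)
  also have "\<dots> \<le> hom C d c"
    using mult_lower_le[OF d assms(2), of "\<lambda>c'\<in>ob C. hom C c c'"] assms(2) by simp
  finally have "lower C (\<lambda>c'\<in>ob C. hom C c c') d \<le> hom C d c"
    by simp
  moreover have "hom C d c \<le> lower C (\<lambda>c'\<in>ob C. hom C c c') d"
    using assms d by (simp add: le_lower_iff qcategory_comp)
  ultimately show "lower C (\<lambda>c'\<in>ob C. hom C c c') d = (\<lambda>c'\<in>ob C. hom C c' c) d"
    using d by simp
qed (simp_all add: lower_def)

lemma macneille_embedding_in_ob:
  assumes "qcategory C" "c \<in> ob C"
  shows "macneille_embedding C c \<in> ob (macneille C)"
  unfolding macneille_embedding_def
  by (rule macneille_obI[OF assms(1)])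
    (simp_all only: upper_representable[OF assms] lower_representable[OF assms])

text \<open>Yoneda: the presheaf law of \<open>fst M\<close> gives one inequality, evaluation at the
  identity of \<open>c\<close> the other.\<close>

lemma macneille_hom_from_representable:
  assumes "qcategory C" "c \<in> ob C" "M \<in> ob (macneille C)"
  shows "hom (macneille C) (macneille_embedding C c) M = fst M c"
proof (rule antisym)
  show "fst M c \<le> hom (macneille C) (macneille_embedding C c) M"
    using assms(2) macneille_ob(1)[OF assms(3)]
    by (simp add: le_macneille_hom_iff macneille_embedding_def presheaf_def)
  let ?h = "hom (macneille C) (macneille_embedding C c) M"
  have "?h * 1 \<le> ?h * hom C c c"
    by (intro quantale_mult_left_mono qcategory_id assms)
  also have "\<dots> \<le> fst M c"
    using macneille_hom_mult_le[OF assms(2), of "macneille_embedding C c" M] assms(2)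
    by (simp add: macneille_embedding_def)
  finally show "?h \<le> fst M c"
    by simp
qed

text \<open>Since \<open>snd M = upper C (fst M)\<close>, residuation shows that the same elements
  lie below both sides.\<close>

lemma macneille_hom_to_representable:
  assumes "qcategory C" "c \<in> ob C" "M \<in> ob (macneille C)"
  shows "hom (macneille C) M (macneille_embedding C c) = snd M c"
proof -
  have "x \<le> hom (macneille C) M (macneille_embedding C c) \<longleftrightarrow> x \<le> snd M c" for x
    using assms(2)
    by (simp add: le_macneille_hom_iff le_upper_iff macneille_embedding_def
        flip: macneille_ob(3)[OF assms(3)])
  then show ?thesis
    by (metis antisym order_refl)
qed

text \<open>Full faithfulness is the Yoneda lemma with \<open>M\<close> itself
  representable.\<close>

lemma embedding_macneille_embedding:
  assumes "qcategory C"
  shows "embedding C (macneille C) (macneille_embedding C)"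
proof -
  have "hom (macneille C) (macneille_embedding C c) (macneille_embedding C c') = hom C c c'"
    if "c \<in> ob C" "c' \<in> ob C" for c c'
    using assms that macneille_hom_from_representable[OF assms that(1) macneille_embedding_in_ob]
    by (simp add: macneille_embedding_def)
  then show ?thesis
    using assms macneille_embedding_in_ob[OF assms]
    by (auto simp: embedding_def qfunctor_def qcategory_macneille)
qed

section \<open>Essentiality of the canonical embedding\<close>

lemma essential_embedding_macneille_embedding:
  assumes C: "qcategory C"
  shows "essential_embedding TYPE('z) C (macneille C) (macneille_embedding C)"
  unfolding essential_embedding_def
proof (intro conjI allI impI embedding_macneille_embedding[OF C])
  fix E :: "('z, 'b) qcat" and g
  let ?i = "macneille_embedding C"
  assume g: "qfunctor (macneille C) E g" and gi: "embedding C E (g \<circ> ?i)"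
  have E: "qcategory E" and gob: "\<And>M. M \<in> ob (macneille C) \<Longrightarrow> g M \<in> ob E"
    and ghom: "\<And>M M'. M \<in> ob (macneille C) \<Longrightarrow> M' \<in> ob (macneille C) \<Longrightarrow>
      hom (macneille C) M M' \<le> hom E (g M) (g M')"
    using g by (auto simp: qfunctor_def)
  note iob = macneille_embedding_in_ob[OF C]
  have "hom E (g M) (g M') \<le> hom (macneille C) M M'"
    if M: "M \<in> ob (macneille C)" and M': "M' \<in> ob (macneille C)" for M M'
    unfolding le_macneille_hom_iff
  proof
    fix c assume c: "c \<in> ob C"
    \<comment> \<open>As \<open>fst M'\<close> is \<open>lower C (snd M')\<close>, a bound by
      \<open>fst M' c\<close> can be tested against every value \<open>snd M' c'\<close>.\<close>
    have "snd M' c' * (hom E (g M) (g M') * fst M c) \<le> hom C c c'" if c': "c' \<in> ob C" for c'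
    proof -
      have "fst M c \<le> hom E (g (?i c)) (g M)"
        using ghom[OF iob[OF c] M] by (simp add: macneille_hom_from_representable[OF C c M])
      then have "hom E (g M) (g M') * fst M c \<le> hom E (g (?i c)) (g M')"
        by (rule qcategory_comp_le[OF E gob[OF iob[OF c]] gob[OF M] gob[OF M'] order_refl])
      moreover have "snd M' c' \<le> hom E (g M') (g (?i c'))"
        using ghom[OF M' iob[OF c']] by (simp add: macneille_hom_to_representable[OF C c' M'])
      ultimately have "snd M' c' * (hom E (g M) (g M') * fst M c) \<le> hom E (g (?i c)) (g (?i c'))"
        by (intro qcategory_comp_le[OF E gob[OF iob[OF c]] gob[OF M'] gob[OF iob[OF c']]])
      then show ?thesis
        using gi c c' by (simp add: embedding_def)
    qed
    then have "hom E (g M) (g M') * fst M c \<le> lower C (snd M') c"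
      using c by (simp add: le_lower_iff)
    then show "hom E (g M) (g M') * fst M c \<le> fst M' c"
      by (simp add: macneille_ob(2)[OF M'])
  qed
  then show "embedding (macneille C) E g"
    using g ghom by (auto simp: embedding_def intro: antisym)
qed

section \<open>Injectivity of the completion\<close>

lemma injective_macneille:
  assumes C: "qcategory C"
  shows "injective TYPE('x) TYPE('y) (macneille C)"
  unfolding injective_def
proof (intro conjI allI impI qcategory_macneille)
  fix X :: "('x, 'b) qcat" and Y :: "('y, 'b) qcat" and f i
  assume f: "qfunctor X (macneille C) f" and i: "embedding X Y i"
  have X: "qcategory X" and Y: "qcategory Y" and iob: "\<And>x. x \<in> ob X \<Longrightarrow> i x \<in> ob Y"
    and ihom: "\<And>x x'. x \<in> ob X \<Longrightarrow> x' \<in> ob X \<Longrightarrow> hom Y (i x) (i x') = hom X x x'"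
    using i by (auto simp: embedding_def qfunctor_def)
  have fob: "\<And>x. x \<in> ob X \<Longrightarrow> f x \<in> ob (macneille C)"
    and fhom: "\<And>x x'. x \<in> ob X \<Longrightarrow> x' \<in> ob X \<Longrightarrow> hom X x x' \<le> hom (macneille C) (f x) (f x')"
    using f by (auto simp: qfunctor_def)
  define S where "S y = (\<lambda>c\<in>ob C. SUP x\<in>ob X. hom Y (i x) y * fst (f x) c)" for y
  define g where "g y = (lower C (upper C (S y)), upper C (S y))" for y
  \<comment> \<open>The triangle identity makes the closure of any family an object.\<close>
  have gob: "g y \<in> ob (macneille C)" for y
    unfolding g_def by (rule macneille_obI[OF C]) (simp_all only: upper_lower_upper)
  \<comment> \<open>The factor \<open>hom Y y y'\<close> moves inside the supremum and is absorbed
    by composition in \<open>Y\<close>.\<close>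
  have S_hom: "hom Y y y' * S y c \<le> S y' c" if y: "y \<in> ob Y" "y' \<in> ob Y" and c: "c \<in> ob C" for y y' c
  proof -
    have "hom Y y y' * (hom Y (i x) y * fst (f x) c) \<le> S y' c" if x: "x \<in> ob X" for x
    proof -
      have "hom Y y y' * hom Y (i x) y * fst (f x) c \<le> hom Y (i x) y' * fst (f x) c"
        by (intro quantale_mult_right_mono qcategory_comp Y iob x y)
      also have "\<dots> \<le> S y' c"
        using c x by (auto simp: S_def intro: SUP_upper)
      finally show ?thesis
        by (simp add: mult.assoc)
    qed
    then show ?thesis
      using c by (simp add: S_def mult_Sup_distrib image_image SUP_le_iff)
  qed
  \<comment> \<open>The scalar \<open>hom Y y y'\<close> changes side under \<open>upper\<close> and
    returns under \<open>lower\<close>, so the closure keeps the bound on \<open>S\<close>.\<close>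
  have ghom: "hom Y y y' \<le> hom (macneille C) (g y) (g y')" if "y \<in> ob Y" "y' \<in> ob Y" for y y'
    using S_hom[OF that] by (auto simp: le_macneille_hom_iff g_def intro!: lower_mult_le mult_upper_le)
  have "g (i x) = f x" if x: "x \<in> ob X" for x
  proof -
    \<comment> \<open>Functoriality of \<open>f\<close> bounds every term of the supremum; the term
      at \<open>x\<close> itself, with \<open>1 \<le> hom X x x\<close>, attains the bound. Full
      faithfulness of \<open>i\<close> is what turns homs of \<open>Y\<close> into homs of
      \<open>X\<close> here.\<close>
    have "S (i x) = fst (f x)"
    proof (rule extensionalityI[of _ "ob C"])
      show "fst (f x) \<in> extensional (ob C)"
        using macneille_ob(1)[OF fob[OF x]] by (simp add: presheaf_def)
      fix c assume c: "c \<in> ob C"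
      have "hom X x' x * fst (f x') c \<le> fst (f x) c" if "x' \<in> ob X" for x'
        using fhom[OF that x] c by (simp add: le_macneille_hom_iff)
      then have "S (i x) c \<le> fst (f x) c"
        using c x by (auto simp: S_def ihom intro: SUP_least)
      moreover have "1 * fst (f x) c \<le> hom X x x * fst (f x) c"
        by (intro quantale_mult_right_mono qcategory_id X x)
      then have "fst (f x) c \<le> S (i x) c"
        using c x by (auto simp: S_def ihom intro: SUP_upper2)
      ultimately show "S (i x) c = fst (f x) c"
        by (rule antisym)
    qed (simp add: S_def)
    then show ?thesis
      by (simp add: g_def macneille_ob[OF fob[OF x]])
  qed
  moreover have "qfunctor Y (macneille C) g"
    using Y gob ghom by (auto simp: qfunctor_def qcategory_macneille)
  ultimately show "\<exists>g. qfunctor Y (macneille C) g \<and> (\<forall>x\<in>ob X. f x = (g \<circ> i) x)"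
    by (intro exI[of _ g]) simp
qed

theorem theorem1p5:
  fixes C :: "('a, 'q::quantale) qcat"
  assumes "qcategory C"
  shows "injective_envelope TYPE('x) TYPE('y) TYPE('z) C (macneille C) (macneille_embedding C)"
  unfolding injective_envelope_def
  using assms by (intro conjI injective_macneille essential_embedding_macneille_embedding)

end
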